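(* Let $E_{\lambda,f}=\sum_{n=1}^{\infty}\mathbf{1}_n$ and $E_{\lambda,g}=\sum_{n=0}^{\infty}\mathbf{1}_n$ in $\widehat{\mathrm{Sh}}_\lambda(\mathbb{R})$ (that is, $f(n)=1$ for all $n\ge1$ and $g(n)=1$ for all $n\ge0$). Then $$E_{\lambda,g}(E_{\lambda,f})=\begin{cases}1+\displaystyle\sum_{n=1}^{\infty}B(n)\,\mathbf{1}_n,&\lambda=0,\\[6pt] 1+\displaystyle\sum_{n=1}^{\infty}\overline{B}(n)\,\mathbf{1}_n,&\lambda=1,\end{cases}$$ where $B(n)$ is the $n$-th Bell number and $\overline{B}(n)$ is the number of generalized partitions of $[n]$.
   Context: For $\lambda\in\mathbb{R}$, $\widehat{\mathrm{Sh}}_\lambda(\mathbb{R})=\prod_{k\ge 0}\mathbb{R}\,\mathbf{1}_k$ is the commutative $\mathbb{R}$-algebra of all formal infinite sums $\sum_{k\ge 0}a_k\mathbf{1}_k$, with product $\diamond$ given on basis elements by $$\mathbf{1}_m\diamond\mathbf{1}_n=\sum_{i=0}^{\min(m,n)}\lambda^i\binom{m+n-i}{m}\binom{m}{i}\mathbf{1}_{m+n-i}$$ ($\lambda^0=1$, also for $\lambda=0$) and extended to infinite sums by distributivity. The unit is $\mathbf{1}_0=1$. For $g$ defined on $\{0,1,2,\dots\}$ put $E_{\lambda,g}=\sum_{n\ge0}g(n)\mathbf{1}_n$; for $f$ defined on $\{1,2,\dots\}$ put $E_{\lambda,f}=\sum_{n\ge1}f(n)\mathbf{1}_n$. Operators: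 $d_A(\sum_{n\ge0}a_n\mathbf{1}_n)=\sum_{n\ge0}a_{n+1}\mathbf{1}_n$ and $P_A(\sum_{n\ge0}a_n\mathbf{1}_n)=\sum_{n\ge1}a_{n-1}\mathbf{1}_n$. Divided powers: $E_{\lambda,f^{[0]}}=1$ and $E_{\lambda,f^{[n]}}=P_A\big(E_{\lambda,f^{[n-1]}}\diamond d_A(E_{\lambda,f})\big)$ for $n\ge1$. Composition: $E_{\lambda,g}(E_{\lambda,f})=\sum_{k\ge0}g(k)E_{\lambda,f^{[k]}}$ (each coefficient is a finite sum, since $E_{\lambda,f^{[k]}}$ involves only $\mathbf{1}_n$ with $n\ge k$). A generalized partition (with distinct max) of $[n]=\{1,\dots,n\}$ is a collection $\{B_1,\dots,B_k\}$ of nonempty subsets of $[n]$ with $B_1\cup\cdots\cup B_k=[n]$ and $\max B_1<\cdots<\max B_k$ (blocks may overlap; $k\ge1$ arbitrary). The Bell number $B(n)$ is the number of set partitions of $[n]$. *)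

theory Defs
  imports Complex_Main "HOL-Library.Disjoint_Sets"
begin

text \<open>A formal infinite sum \<open>\<Sum>k. a k \<one>\<^sub>k\<close> is represented by its coefficient sequence \<open>a\<close>.
  The weight \<open>\<lambda>\<close> (written \<open>l\<close>) is an explicit parameter of the product.\<close>

type_synonym sh = "nat \<Rightarrow> real"

definition sh_basis :: "nat \<Rightarrow> sh" where
  "sh_basis k = (\<lambda>N. if N = k then 1 else 0)"

definition sh_add :: "sh \<Rightarrow> sh \<Rightarrow> sh" where
  "sh_add a b = (\<lambda>N. a N + b N)"

definition sh_basis_mult :: "real \<Rightarrow> nat \<Rightarrow> nat \<Rightarrow> sh" where
  "sh_basis_mult l m n =
     (\<lambda>N. \<Sum>i\<le>min m n. l ^ i * real ((m + n - i) choose m) * real (m choose i)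
              * sh_basis (m + n - i) N)"

text \<open>Extension to infinite sums: the coefficient of \<open>\<one>\<^sub>N\<close> in \<open>\<one>\<^sub>m \<diamond> \<one>\<^sub>n\<close> vanishes unless
  \<open>m \<le> N\<close> and \<open>n \<le> N\<close> (lemma \<open>sh_basis_mult_eq_0\<close> below), so the distributive expansion
  is a finite sum in each coefficient.\<close>

definition sh_mult :: "real \<Rightarrow> sh \<Rightarrow> sh \<Rightarrow> sh" where
  "sh_mult l a b = (\<lambda>N. \<Sum>m\<le>N. \<Sum>n\<le>N. a m * b n * sh_basis_mult l m n N)"

lemma sh_basis_mult_eq_0:
  assumes "N < m \<or> N < n"
  shows "sh_basis_mult l m n N = 0"
  unfolding sh_basis_mult_def sh_basis_def
  using assms by (intro sum.neutral) auto

lemma sh_mult_basis: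
  "sh_mult l (sh_basis m) (sh_basis n) = sh_basis_mult l m n"
proof
  fix N
  have "sh_mult l (sh_basis m) (sh_basis n) N =
    (\<Sum>m'\<le>N. if m' = m then (\<Sum>n'\<le>N. if n' = n then sh_basis_mult l m n N else 0) else 0)"
    unfolding sh_mult_def sh_basis_def
    by (rule sum.cong[OF refl], case_tac "x = m") (auto intro!: sum.cong simp del: sum.delta sum.delta')
  also have "\<dots> = sh_basis_mult l m n N"
    using sh_basis_mult_eq_0[of N m n l] by (auto simp: not_le)
  finally show "sh_mult l (sh_basis m) (sh_basis n) N = sh_basis_mult l m n N" .
qed

definition sh_d :: "sh \<Rightarrow> sh" where
  "sh_d a = (\<lambda>n. a (Suc n))"

definition sh_P :: "sh \<Rightarrow> sh" where
  "sh_P a = (\<lambda>n. if n = 0 then 0 else a (n - 1))"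

text \<open>\<open>sh_E\<close> is for functions on \<open>{0,1,2,\<dots>}\<close>; \<open>sh_E1\<close> is for functions on \<open>{1,2,\<dots>}\<close>,
  whose value at \<open>0\<close> is ignored.\<close>

definition sh_E :: "(nat \<Rightarrow> real) \<Rightarrow> sh" where
  "sh_E g = (\<lambda>n. g n)"

definition sh_E1 :: "(nat \<Rightarrow> real) \<Rightarrow> sh" where
  "sh_E1 f = (\<lambda>n. if n = 0 then 0 else f n)"

fun sh_divpow :: "real \<Rightarrow> sh \<Rightarrow> nat \<Rightarrow> sh" where
  "sh_divpow l F 0 = sh_basis 0"
| "sh_divpow l F (Suc k) = sh_P (sh_mult l (sh_divpow l F k) (sh_d F))"

lemma sh_divpow_eq_0: "N < k \<Longrightarrow> sh_divpow l F k N = 0"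
  by (induction k arbitrary: N) (auto simp: sh_P_def sh_mult_def intro!: sum.neutral)

text \<open>The composition \<open>G(F) = \<Sum>k. G k F\<^sup>[\<^sup>k\<^sup>]\<close>; by \<open>sh_divpow_eq_0\<close>, only \<open>k \<le> N\<close> contributes
  to the coefficient of \<open>\<one>\<^sub>N\<close>.\<close>

definition sh_compose :: "real \<Rightarrow> sh \<Rightarrow> sh \<Rightarrow> sh" where
  "sh_compose l G F = (\<lambda>N. \<Sum>k\<le>N. G k * sh_divpow l F k N)"

definition Bell :: "nat \<Rightarrow> nat" where
  "Bell n = card {P. partition_on {1..n} P}"

definition gen_partition :: "nat \<Rightarrow> nat set set \<Rightarrow> bool" where
  "gen_partition n P \<longleftrightarrow>
     (\<exists>Bs. P = set Bs \<and> Bs \<noteq> [] \<and> (\<forall>B\<in>set Bs. B \<noteq> {} \<and> B \<subseteq> {1..n}) \<and>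
           \<Union> (set Bs) = {1..n} \<and> sorted_wrt (\<lambda>B C. Max B < Max C) Bs)"

definition gen_Bell :: "nat \<Rightarrow> nat" where
  "gen_Bell n = card {P. gen_partition n P}"

end

theory Submission
  imports Defs
begin

text \<open>Write \<open>b N\<close> for the coefficient of \<open>\<one>\<^sub>N\<close> in the composition. Since
  \<open>d\<^sub>A(E\<^sub>f)\<close> is the all-one sequence \<open>u\<close>, and the coefficient of \<open>\<one>\<^sub>N\<close> in \<open>a \<diamond> u\<close> is
  \<open>\<Sum>m\<le>N. (N choose m) (1 + \<lambda>)\<^sup>m a\<^sub>m\<close>, one gets \<open>b 0 = 1\<close> and
  \<open>b (N + 1) = \<Sum>m\<le>N. (N choose m) (1 + \<lambda>)\<^sup>m b m\<close>. The same recursion counts (generalized)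
  partitions of a set \<open>S \<union> {m}\<close> with \<open>m > max S\<close>: the blocks without \<open>m\<close> partition a subset
  \<open>A\<close> of \<open>S\<close>, and the block with \<open>m\<close> is \<open>C \<union> {m}\<close> with \<open>S - A \<subseteq> C \<subseteq> S\<close>. For set partitions
  \<open>C = S - A\<close> is forced; for generalized partitions there are \<open>2\<^bsup>|A|\<^esup>\<close> choices.\<close>

section \<open>Coefficients of the composition\<close>

text \<open>For each \<open>i \<le> m\<close> exactly one \<open>n\<close>, namely
  \<open>N - m + i\<close>, puts the \<open>i\<close>-th term of the product in degree
  \<open>N\<close>. The sum over \<open>i\<close> is then a binomial expansion.\<close>

lemma sum_sh_basis_mult:
  assumes "m \<le> N"
  shows "(\<Sum>n\<le>N. sh_basis_mult l m n N) = real (N choose m) * (1 + l) ^ m"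
proof -
  let ?c = "\<lambda>i. l ^ i * real (N choose m) * real (m choose i)"
  have "(\<Sum>n\<le>N. sh_basis_mult l m n N) =
      (\<Sum>n\<le>N. \<Sum>i\<le>m. if n = N - m + i then ?c i else 0)"
  proof (intro sum.cong refl)
    fix n assume "n \<in> {..N}"
    have "sh_basis_mult l m n N = (\<Sum>i\<le>min m n. if n = N - m + i then ?c i else 0)"
      unfolding sh_basis_mult_def sh_basis_def
      using assms by (intro sum.cong refl) auto
    \<comment> \<open>The indices added here have \<open>i > n\<close>, but
      \<open>n = N - m + i\<close> forces \<open>i \<le> n\<close>.\<close>
    also have "\<dots> = (\<Sum>i\<le>m. if n = N - m + i then ?c i else 0)"
      by (intro sum.mono_neutral_left) auto
    finally show "sh_basis_mult l m n N = \<dots>" .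
  qed
  also have "\<dots> = (\<Sum>i\<le>m. \<Sum>n\<le>N. if n = N - m + i then ?c i else 0)"
    by (rule sum.swap)
  also have "\<dots> = (\<Sum>i\<le>m. ?c i)"
    using assms by (intro sum.cong refl) auto
  also have "\<dots> = real (N choose m) * (l + 1) ^ m"
    by (subst binomial_ring) (simp add: sum_distrib_left mult_ac)
  finally show ?thesis by (simp add: add.commute)
qed

lemma sh_mult_one:
  "sh_mult l a (\<lambda>_. 1) N = (\<Sum>m\<le>N. real (N choose m) * (1 + l) ^ m * a m)"
proof -
  have "sh_mult l a (\<lambda>_. 1) N = (\<Sum>m\<le>N. a m * (\<Sum>n\<le>N. sh_basis_mult l m n N))"
    by (simp add: sh_mult_def sum_distrib_left)
  also have "\<dots> = (\<Sum>m\<le>N. real (N choose m) * (1 + l) ^ m * a m)"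
    by (intro sum.cong refl) (simp add: sum_sh_basis_mult)
  finally show ?thesis .
qed

lemma sh_compose_one_0:
  "sh_compose l (\<lambda>_. 1) F 0 = 1"
  by (simp add: sh_compose_def sh_basis_def)

lemma sh_compose_one_Suc:
  assumes "sh_d F = (\<lambda>_. 1)"
  shows "sh_compose l (\<lambda>_. 1) F (Suc N) =
    (\<Sum>m\<le>N. real (N choose m) * (1 + l) ^ m * sh_compose l (\<lambda>_. 1) F m)"
proof -
  let ?D = "sh_divpow l F"
  \<comment> \<open>The term \<open>k = 0\<close> drops out because \<open>sh_basis 0\<close>
    vanishes at \<open>Suc N\<close>.\<close>
  have "sh_compose l (\<lambda>_. 1) F (Suc N) = (\<Sum>k\<le>N. ?D (Suc k) (Suc N))"
    unfolding sh_compose_def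
    by (subst sum.atMost_Suc_shift) (simp add: sh_basis_def)
  also have "\<dots> = (\<Sum>k\<le>N. \<Sum>m\<le>N. real (N choose m) * (1 + l) ^ m * ?D k m)"
    by (simp add: assms sh_P_def sh_mult_one)
  also have "\<dots> = (\<Sum>m\<le>N. real (N choose m) * (1 + l) ^ m * (\<Sum>k\<le>N. ?D k m))"
    by (subst sum.swap) (simp add: sum_distrib_left)
  \<comment> \<open>A \<open>k\<close>-th divided power has no terms below degree \<open>k\<close>,
    so the inner sum may stop at \<open>m\<close>.\<close>
  also have "\<dots> = (\<Sum>m\<le>N. real (N choose m) * (1 + l) ^ m * (\<Sum>k\<le>m. ?D k m))"
    by (intro sum.cong refl arg_cong2[where f = times] sum.mono_neutral_right)
       (auto simp: sh_divpow_eq_0)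
  finally show ?thesis by (simp add: sh_compose_def)
qed

section \<open>Counting block systems by removing the largest element\<close>

lemma sum_Pow_card:
  fixes h :: "nat \<Rightarrow> 'b::comm_semiring_1"
  assumes "finite S"
  shows "(\<Sum>A\<in>Pow S. h (card A)) = (\<Sum>m\<le>card S. of_nat (card S choose m) * h m)"
proof -
  have "(\<Sum>A\<in>Pow S. h (card A)) = (\<Sum>m\<le>card S. \<Sum>A\<in>{A \<in> Pow S. card A = m}. h (card A))"
    using assms by (intro sum.group [symmetric]) (auto intro: card_mono)
  also have "\<dots> = (\<Sum>m\<le>card S. of_nat (card S choose m) * h m)"
    using n_subsets[OF assms] by (intro sum.cong refl) simp
  finally show ?thesis .
qed

text \<open>\<open>F A\<close> is a family of block systems covering \<open>A\<close>, and \<open>K S A\<close> is the set of admissible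
  completions of the block of the new maximum.\<close>

lemma card_block_systems:
  fixes F :: "nat set \<Rightarrow> nat set set set" and b :: "nat \<Rightarrow> real"
  assumes F_empty: "F {} = {{}}"
    and Union_F: "\<And>A Q. Q \<in> F A \<Longrightarrow> \<Union>Q = A"
    and K_subset: "\<And>S A C. A \<subseteq> S \<Longrightarrow> C \<in> K S A \<Longrightarrow> C \<subseteq> S"
    and card_K: "\<And>S A. finite S \<Longrightarrow> A \<subseteq> S \<Longrightarrow> real (card (K S A)) = q ^ card A"
    and F_insert: "\<And>S m. finite S \<Longrightarrow> \<forall>s\<in>S. s < m \<Longrightarrow>
      F (insert m S) = (\<lambda>(A, Q, C). insert (insert m C) Q) ` (SIGMA A:Pow S. F A \<times> K S A)"
    and b_0: "b 0 = 1"
    and b_Suc: "\<And>N. b (Suc N) = (\<Sum>m\<le>N. real (N choose m) * q ^ m * b m)"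
    and "finite S"
  shows "real (card (F S)) = b (card S)"
  using \<open>finite S\<close>
proof (induction S rule: finite_psubset_induct)
  case (psubset S)
  show ?case
  proof (cases "S = {}")
    case True
    then show ?thesis by (simp add: F_empty b_0)
  next
    case False
    define m T where "m = Max S" and "T = S - {m}"
    have "m \<in> S"
      using psubset.hyps False unfolding m_def by (rule Max_in)
    then have S: "S = insert m T" and "m \<notin> T" and fin: "finite T" and less: "\<forall>s\<in>T. s < m"
      using psubset.hyps Max_ge[of S]
      by (auto simp: m_def T_def order.strict_iff_order)
    let ?X = "SIGMA A:Pow T. F A \<times> K T A"
    have finF: "finite (F A)" if "finite A" for A
      using that Union_F by (intro finite_subset[of "F A" "Pow (Pow A)"]) auto
    have finK: "finite (K T A)" if "A \<subseteq> T" for A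
      using K_subset[OF that] fin by (meson Pow_iff finite_Pow_iff finite_subset subsetI)
    \<comment> \<open>The triple can be read off its image: \<open>Q\<close> consists of the blocks
      avoiding \<open>m\<close>, \<open>A\<close> is the union of \<open>Q\<close>, and the one
      remaining block is \<open>insert m C\<close>.\<close>
    have inj: "inj_on (\<lambda>(A, Q, C). insert (insert m C) Q) ?X"
    proof (rule inj_onI)
      fix x y assume "x \<in> ?X" "y \<in> ?X" and
        xy: "(\<lambda>(A, Q, C). insert (insert m C) Q) x = (\<lambda>(A, Q, C). insert (insert m C) Q) y"
      then obtain A Q C A' Q' C' where x: "x = (A, Q, C)" and y: "y = (A', Q', C')"
        and A: "A \<subseteq> T" "Q \<in> F A" "C \<in> K T A" and A': "A' \<subseteq> T" "Q' \<in> F A'" "C' \<in> K T A'"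
        by auto
      have eq: "insert (insert m C) Q = insert (insert m C') Q'"
        using xy x y by simp
      have *: "m \<notin> \<Union>Q" "m \<notin> \<Union>Q'" "m \<notin> C" "m \<notin> C'"
        using A A' Union_F K_subset \<open>m \<notin> T\<close> by blast+
      have "Q = {B \<in> insert (insert m C) Q. m \<notin> B}" "Q' = {B \<in> insert (insert m C') Q'. m \<notin> B}"
        using * by auto
      with eq have "Q = Q'" by simp
      moreover have "A = A'"
        using Union_F A A' \<open>Q = Q'\<close> by metis
      moreover have "insert m C = insert m C'"
        using eq * by (metis Union_iff insertCI insertE)
      ultimately show "x = y"
        using * x y by (metis insert_ident)
    qed
    have "real (card (F S)) = real (card ?X)"
      using F_insert[OF fin less] by (simp add: S card_image[OF inj])
    also have "\<dots> = (\<Sum>A\<in>Pow T. real (card (F A)) * real (card (K T A)))"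
      using fin finF finK
      by (subst card_SigmaI) (auto simp: card_cartesian_product intro!: finite_cartesian_product intro: finite_subset)
    also have "\<dots> = (\<Sum>A\<in>Pow T. q ^ card A * b (card A))"
    proof (intro sum.cong refl)
      fix A assume A: "A \<in> Pow T"
      \<comment> \<open>The set \<open>A\<close> misses \<open>m\<close>, so the induction
        hypothesis applies to it.\<close>
      then have "A \<subset> S" using S \<open>m \<notin> T\<close> by blast
      with A show "real (card (F A)) * real (card (K T A)) = q ^ card A * b (card A)"
        using psubset.IH[of A] card_K[OF fin, of A] by simp
    qed
    also have "\<dots> = b (Suc (card T))"
      using sum_Pow_card[OF fin, of "\<lambda>m. q ^ m * b m"] by (simp add: b_Suc mult.assoc)
    also have "Suc (card T) = card S"
      using S fin \<open>m \<notin> T\<close> by simp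
    finally show ?thesis .
  qed
qed

section \<open>Ordinary and generalized partitions as block systems\<close>

lemma partition_on_insert_Max:
  assumes "m \<notin> S"
  shows "{P. partition_on (insert m S) P} = (\<lambda>(A, Q, C). insert (insert m C) Q) `
    (SIGMA A:Pow S. {Q. partition_on A Q} \<times> {S - A})" (is "?L = ?R")
proof
  show "?L \<subseteq> ?R"
  proof
    fix P assume "P \<in> ?L"
    then have P: "partition_on (insert m S) P" by simp
    then obtain B where B: "B \<in> P" "m \<in> B" by (auto simp: partition_on_def)
    \<comment> \<open>Disjointness makes the block of \<open>m\<close> the exact complement of what
      the other blocks cover.\<close>
    let ?A = "\<Union>(P - {B})"
    have disj: "B \<inter> ?A = {}"
      using partition_onD2[OF P] B(1) by (auto simp: disjoint_def)
    have Un: "B \<union> ?A = insert m S"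
      using partition_onD1[OF P] B(1) by blast
    have "?A \<subseteq> S" "B = insert m (S - ?A)"
      using disj Un B(2) assms by blast+
    moreover have "partition_on ?A (P - {B})"
      using P by (auto simp: partition_on_def disjoint_def)
    moreover have "P = insert B (P - {B})"
      using B(1) by blast
    ultimately show "P \<in> ?R"
      by (intro image_eqI[where x = "(?A, P - {B}, S - ?A)"]) auto
  qed
  show "?R \<subseteq> ?L"
    using assms by (auto simp: partition_on_def disjoint_def)
qed

text \<open>Injectivity of \<open>Max\<close> replaces the increasing list of blocks. An arbitrary
  ground set lets the induction pass to subsets; the empty set has the empty family as its only
  cover, which starts the recursion at 1.\<close>

definition distinct_max_cover :: "nat set \<Rightarrow> nat set set \<Rightarrow> bool" where
  "distinct_max_cover S P \<longleftrightarrow> \<Union>P = S \<and> {} \<notin> P \<and> inj_on Max P"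

text \<open>Every block containing \<open>m\<close> has maximum \<open>m\<close>, so distinct maxima
  allow only one such block. Its other elements must fill the gap \<open>S - A\<close> and may
  overlap \<open>A\<close> freely.\<close>

lemma distinct_max_cover_insert_Max:
  assumes fin: "finite S" and less: "\<forall>s\<in>S. s < m"
  shows "{P. distinct_max_cover (insert m S) P} = (\<lambda>(A, Q, C). insert (insert m C) Q) `
    (SIGMA A:Pow S. {Q. distinct_max_cover A Q} \<times> {C. S - A \<subseteq> C \<and> C \<subseteq> S})" (is "?L = ?R")
proof
  have Max_eq: "Max B = m" if "B \<subseteq> insert m S" "m \<in> B" for B
    using that fin less by (intro Max_eqI) (auto intro: finite_subset order.strict_implies_order)
  have Max_in_S: "Max B \<in> S" if "B \<subseteq> S" "B \<noteq> {}" for B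
    using that fin Max_in[of B] by (meson finite_subset subsetD)
  show "?L \<subseteq> ?R"
  proof
    fix P assume "P \<in> ?L"
    then have Un: "\<Union>P = insert m S" and ne: "{} \<notin> P" and inj: "inj_on Max P"
      by (auto simp: distinct_max_cover_def)
    then obtain B where B: "B \<in> P" "m \<in> B" by blast
    let ?A = "\<Union>(P - {B})"
    have "B' = B" if "B' \<in> P" "m \<in> B'" for B'
      using that B Un Max_eq inj by (metis Union_upper inj_onD)
    then have "m \<notin> ?A" by blast
    moreover have "?A \<subseteq> insert m S" unfolding Un[symmetric] by blast
    ultimately have "?A \<subseteq> S" by (simp add: subset_insert)
    moreover have "distinct_max_cover ?A (P - {B})"
      using ne inj by (auto simp: distinct_max_cover_def intro: inj_on_diff)
    moreover have "S - ?A \<subseteq> B - {m}"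
    proof
      fix s assume s: "s \<in> S - ?A"
      then have "s \<in> \<Union>P" using Un by simp
      with s show "s \<in> B - {m}" using less by blast
    qed
    moreover have "B \<subseteq> insert m S" unfolding Un[symmetric] using B(1) by (rule Union_upper)
    then have "B - {m} \<subseteq> S" by blast
    moreover have "P = insert (insert m (B - {m})) (P - {B})"
      using B by (simp add: insert_absorb)
    ultimately show "P \<in> ?R"
      by (intro image_eqI[where x = "(?A, P - {B}, B - {m})"]) auto
  qed
  show "?R \<subseteq> ?L"
  proof clarify
    fix A Q C
    assume A: "A \<subseteq> S" and Q: "distinct_max_cover A Q" and C: "S - A \<subseteq> C" "C \<subseteq> S"
    have "Max (insert m C) = m"
      using C(2) by (intro Max_eq) auto
    \<comment> \<open>Old blocks lie in \<open>S\<close>, so their maxima stay below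
      \<open>m\<close>.\<close>
    moreover have "Max B \<noteq> m" if "B \<in> Q" for B
      using that Q A less Max_in_S[of B] unfolding distinct_max_cover_def
      by (metis Union_upper nat_neq_iff subset_trans)
    ultimately have "inj_on Max (insert (insert m C) Q)"
      using Q by (auto simp: distinct_max_cover_def inj_on_insert)
    with A Q C show "distinct_max_cover (insert m S) (insert (insert m C) Q)"
      by (auto simp: distinct_max_cover_def)
  qed
qed

text \<open>Such a \<open>C\<close> is determined by \<open>C \<inter> A\<close>, which can be any
  subset of \<open>A\<close>.\<close>

lemma card_between_sets:
  assumes "finite S" "A \<subseteq> S"
  shows "card {C. S - A \<subseteq> C \<and> C \<subseteq> S} = 2 ^ card A"
proof -
  have "bij_betw (\<lambda>X. X \<union> (S - A)) (Pow A) {C. S - A \<subseteq> C \<and> C \<subseteq> S}"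
    using assms(2) by (intro bij_betwI[where g = "\<lambda>C. C \<inter> A"]) auto
  then show ?thesis
    using assms by (simp add: bij_betw_same_card[symmetric] card_Pow finite_subset)
qed

text \<open>The bound \<open>n \<ge> 1\<close> excludes the empty family, which covers the empty set
  but is not a generalized partition.\<close>

lemma gen_partition_iff_distinct_max_cover:
  assumes "n \<ge> 1"
  shows "gen_partition n P \<longleftrightarrow> distinct_max_cover {1..n} P"
proof
  assume "gen_partition n P"
  then obtain Bs where Bs: "P = set Bs" "\<forall>B\<in>set Bs. B \<noteq> {}" "\<Union>(set Bs) = {1..n}"
    and sorted: "sorted_wrt (\<lambda>B C. Max B < Max C) Bs"
    unfolding gen_partition_def by blast
  have "distinct (map Max Bs)"
    using sorted by (simp add: sorted_wrt_map[symmetric] strict_sorted_iff)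
  with Bs show "distinct_max_cover {1..n} P"
    by (auto simp: distinct_max_cover_def distinct_map)
next
  assume P: "distinct_max_cover {1..n} P"
  then have "P \<subseteq> Pow {1..n}" by (auto simp: distinct_max_cover_def)
  then have "finite P" by (rule finite_subset) simp
  then obtain xs where xs: "set xs = P" "distinct xs"
    using finite_distinct_list by blast
  \<comment> \<open>Sorting by \<open>Max\<close> gives weakly increasing maxima; injectivity makes
    them strictly increasing.\<close>
  define Bs where "Bs = sort_key Max xs"
  have "set Bs = P" by (simp add: Bs_def xs)
  moreover have "sorted_wrt (<) (map Max Bs)"
    using P xs by (simp add: strict_sorted_iff distinct_map Bs_def distinct_max_cover_def)
  then have "sorted_wrt (\<lambda>B C. Max B < Max C) Bs"
    by (simp add: sorted_wrt_map)
  moreover have "Bs \<noteq> []"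
    using P assms \<open>set Bs = P\<close> by (auto simp: distinct_max_cover_def)
  ultimately show "gen_partition n P"
    unfolding gen_partition_def using P by (intro exI[of _ Bs]) (auto simp: distinct_max_cover_def)
qed

theorem corollary3p23:
  fixes l :: real and f g :: "nat \<Rightarrow> real"
  assumes "\<forall>n\<ge>1. f n = 1" and "\<forall>n. g n = 1"
  shows "(l = 0 \<longrightarrow> sh_compose l (sh_E g) (sh_E1 f)
                    = sh_add (sh_basis 0) (sh_E1 (\<lambda>n. real (Bell n)))) \<and>
         (l = 1 \<longrightarrow> sh_compose l (sh_E g) (sh_E1 f)
                    = sh_add (sh_basis 0) (sh_E1 (\<lambda>n. real (gen_Bell n))))"
proof (intro conjI impI)
  have g: "sh_E g = (\<lambda>_. 1)" using assms(2) by (simp add: sh_E_def fun_eq_iff)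
  have f: "sh_d (sh_E1 f) = (\<lambda>_. 1)" using assms(1) by (simp add: sh_d_def sh_E1_def)
  note rec = sh_compose_one_0 sh_compose_one_Suc[OF f]
  \<comment> \<open>Only \<open>n \<ge> 1\<close> matters for \<open>c\<close>: \<open>sh_E1\<close>
    ignores its value at 0, and \<open>sh_basis 0\<close> supplies the constant term.\<close>
  have compose_eq: "sh_compose l (sh_E g) (sh_E1 f) = sh_add (sh_basis 0) (sh_E1 (\<lambda>n. real (c n)))"
    if "\<And>n. n \<ge> 1 \<Longrightarrow> real (c n) = sh_compose l (\<lambda>_. 1) (sh_E1 f) n" for c
  proof
    fix n
    show "sh_compose l (sh_E g) (sh_E1 f) n = sh_add (sh_basis 0) (sh_E1 (\<lambda>n. real (c n))) n"
      using that[of n] by (cases "n = 0") (auto simp: g sh_compose_one_0 sh_add_def sh_basis_def sh_E1_def)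
  qed
  show "sh_compose l (sh_E g) (sh_E1 f) = sh_add (sh_basis 0) (sh_E1 (\<lambda>n. real (Bell n)))"
    if "l = 0"
  proof (rule compose_eq)
    fix n :: nat
    \<comment> \<open>Here \<open>q = 1\<close>, matching the single forced completion
      \<open>S - A\<close>.\<close>
    have "real (card {P. partition_on {1..n} P}) = sh_compose l (\<lambda>_. 1) (sh_E1 f) (card {1..n})"
    proof (rule card_block_systems[where F = "\<lambda>S. {P. partition_on S P}"
          and K = "\<lambda>S A. {S - A}" and q = "1 + l", OF _ _ _ _ _ rec])
      show "{P. partition_on (insert m S) P} = (\<lambda>(A, Q, C). insert (insert m C) Q) `
          (SIGMA A:Pow S. {Q. partition_on A Q} \<times> {S - A})" if "\<forall>s\<in>S. s < m" for S and m :: nat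
        using that by (intro partition_on_insert_Max) blast
    qed (use \<open>l = 0\<close> in \<open>auto simp: partition_on_empty partition_on_def\<close>)
    then show "real (Bell n) = sh_compose l (\<lambda>_. 1) (sh_E1 f) n"
      by (simp add: Bell_def)
  qed
  show "sh_compose l (sh_E g) (sh_E1 f) = sh_add (sh_basis 0) (sh_E1 (\<lambda>n. real (gen_Bell n)))"
    if "l = 1"
  proof (rule compose_eq)
    fix n :: nat assume "n \<ge> 1"
    \<comment> \<open>Here \<open>q = 2\<close>, matching the free choice of a subset of
      \<open>A\<close>.\<close>
    have "real (card {P. distinct_max_cover {1..n} P}) =
        sh_compose l (\<lambda>_. 1) (sh_E1 f) (card {1..n})"
      by (rule card_block_systems[where F = "\<lambda>S. {P. distinct_max_cover S P}"
          and K = "\<lambda>S A. {C. S - A \<subseteq> C \<and> C \<subseteq> S}" and q = "1 + l",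
          OF _ _ _ _ distinct_max_cover_insert_Max rec])
        (use \<open>l = 1\<close> in \<open>auto simp: distinct_max_cover_def card_between_sets\<close>)
    then show "real (gen_Bell n) = sh_compose l (\<lambda>_. 1) (sh_E1 f) n"
      using \<open>n \<ge> 1\<close> by (simp add: gen_Bell_def gen_partition_iff_distinct_max_cover)
  qed
qed

end
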